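(* (a) For every integer $m\ge 1$: among the values $t(n)$ for $0\le n< 4^m/2$, the value $0$ occurs exactly $2^{m-1}$ times, and for each $k$ with $1\le k<2^m$ the value $k$ occurs exactly $2^m-k$ times. (b) For every integer $m\ge 0$: among the values $t(n)$ for $0\le n<4^m$, the value $0$ occurs exactly $2^m-1$ times, the value $2^m$ occurs exactly once, and for each $k$ with $1\le k<2^m$ the value $k$ occurs exactly $2(2^m-k)$ times.
   Context: Let $(a(n))_{n\ge 0}$ be the Rudin-Shapiro sequence, defined by $a(0)=1$, $a(2n)=a(n)$, $a(2n+1)=(-1)^n a(n)$ for $n\ge 0$. Let $t(n)=\sum_{0\le i\le n}(-1)^i a(i)$. *)

theory Defs
  imports Main
begin

fun rudin_shapiro :: "nat \<Rightarrow> int" where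
  "rudin_shapiro n =
     (if n = 0 then 1
      else if even n then rudin_shapiro (n div 2)
      else (-1) ^ (n div 2) * rudin_shapiro (n div 2))"

declare rudin_shapiro.simps [simp del]

(* The recurrences a(0) = 1, a(2n) = a(n), a(2n+1) = (-1)^n a(n), which determine the sequence. *)

lemma rudin_shapiro_0: "rudin_shapiro 0 = 1"
  by (subst rudin_shapiro.simps) simp

lemma rudin_shapiro_even: "rudin_shapiro (2 * n) = rudin_shapiro n"
  by (subst rudin_shapiro.simps) (simp add: rudin_shapiro_0)

lemma rudin_shapiro_odd: "rudin_shapiro (2 * n + 1) = (-1) ^ n * rudin_shapiro n"
  by (subst rudin_shapiro.simps) simp

definition rs_alt_sum :: "nat \<Rightarrow> int" where
  "rs_alt_sum n = (\<Sum>i\<le>n. (-1) ^ i * rudin_shapiro i)"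

end

theory Submission
  imports Defs
begin

text \<open>The alternating sums form a walk with steps \<open>\<plusminus>1\<close> that starts at \<open>0\<close>, and refining each step into
  four steps doubles the positions at the multiples of \<open>4\<close>. In the refined walk an even value
  \<open>2j\<close> is therefore hit about twice as often as \<open>j\<close> was hit, while the hits of an odd value
  \<open>2c + 1\<close> come from the even-timed crossings of the edge between \<open>c\<close> and \<open>c + 1\<close>, counted
  twice, and from the visits to the odd one of its end points. Each visit to \<open>j\<close> uses exactly one
  even-timed step, along one of the two edges at \<open>j\<close>, so the crossing numbers follow from the visit
  numbers. Hence visit numbers that are linear on \<open>{1..<w}\<close> become linear on \<open>{1..<2w}\<close>, with the
  same slope: slope 1 for the half range, slope 2 for the full range.\<close>

section \<open>The walk and its self-similarity\<close>

definition alt_sum :: "nat \<Rightarrow> int" where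
  "alt_sum n = (\<Sum>i<n. (-1) ^ i * rudin_shapiro i)"

text \<open>The index shift puts the walk at 0 at time 0, so that refinement doubles positions
  without an offset.\<close>

lemma rs_alt_sum_eq: "rs_alt_sum n = alt_sum (Suc n)"
  by (simp add: rs_alt_sum_def alt_sum_def lessThan_Suc_atMost)

lemma alt_sum_0 [simp]: "alt_sum 0 = 0"
  by (simp add: alt_sum_def)

lemma alt_sum_Suc: "alt_sum (Suc n) = alt_sum n + (-1) ^ n * rudin_shapiro n"
  by (simp add: alt_sum_def)

lemma rudin_shapiro_cases: "rudin_shapiro n = 1 \<or> rudin_shapiro n = -1"
proof (induction n rule: less_induct)
  case (less n)
  show ?case
  proof (cases "n = 0")
    case True
    then show ?thesis by (simp add: rudin_shapiro_0)
  next
    case False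
    then have "rudin_shapiro (n div 2) = 1 \<or> rudin_shapiro (n div 2) = -1"
      using less.IH by simp
    moreover have "(-1) ^ (n div 2) = (1::int) \<or> (-1) ^ (n div 2) = (-1::int)"
      by (cases "even (n div 2)") auto
    ultimately show ?thesis
      by (subst (1 2) rudin_shapiro.simps) auto
  qed
qed

lemma rudin_shapiro_mod4:
  "rudin_shapiro (4 * n) = rudin_shapiro n"
  "rudin_shapiro (4 * n + 1) = rudin_shapiro n"
  "rudin_shapiro (4 * n + 2) = (-1) ^ n * rudin_shapiro n"
  "rudin_shapiro (4 * n + 3) = - ((-1) ^ n * rudin_shapiro n)"
proof -
  have e: "4 * n = 2 * (2 * n)" "4 * n + 1 = 2 * (2 * n) + 1"
    "4 * n + 2 = 2 * (2 * n + 1)" "4 * n + 3 = 2 * (2 * n + 1) + 1"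
    by simp_all
  show "rudin_shapiro (4 * n) = rudin_shapiro n"
    unfolding e(1) rudin_shapiro_even ..
  show "rudin_shapiro (4 * n + 1) = rudin_shapiro n"
    unfolding e(2) rudin_shapiro_odd rudin_shapiro_even by simp
  show "rudin_shapiro (4 * n + 2) = (-1) ^ n * rudin_shapiro n"
    unfolding e(3) rudin_shapiro_even rudin_shapiro_odd ..
  show "rudin_shapiro (4 * n + 3) = - ((-1) ^ n * rudin_shapiro n)"
    unfolding e(4) rudin_shapiro_odd by simp
qed

text \<open>With r = \<open>rudin_shapiro n\<close> and d = \<open>(-1) ^ n * r\<close>, the four
  increments replacing step \<open>n\<close> are r, -r, d, d: an excursion out and back, then the
  original step twice.\<close>

lemma alt_sum_mod4:
  "alt_sum (4 * n) = 2 * alt_sum n"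
  "alt_sum (4 * n + 1) = 2 * alt_sum n + rudin_shapiro n"
  "alt_sum (4 * n + 2) = 2 * alt_sum n"
  "alt_sum (4 * n + 3) = alt_sum n + alt_sum (Suc n)"
proof -
  have step: "alt_sum (4 * k + 1) = alt_sum (4 * k) + rudin_shapiro k"
    "alt_sum (4 * k + 2) = alt_sum (4 * k)"
    "alt_sum (4 * k + 3) = alt_sum (4 * k) + (-1) ^ k * rudin_shapiro k"
    "alt_sum (4 * k + 4) = alt_sum (4 * k) + 2 * ((-1) ^ k * rudin_shapiro k)" for k
  proof -
    have e: "4 * k + 2 = Suc (4 * k + 1)" "4 * k + 3 = Suc (4 * k + 2)" "4 * k + 4 = Suc (4 * k + 3)"
      by simp_all
    have sgn: "(-1) ^ (4 * k) = (1::int)" "(-1) ^ (4 * k + 1) = (-1::int)"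
      "(-1) ^ (4 * k + 2) = (1::int)" "(-1) ^ (4 * k + 3) = (-1::int)"
      by (simp_all add: power_add)
    have s: "alt_sum (4 * k + 1) = alt_sum (4 * k) + rudin_shapiro k"
      "alt_sum (4 * k + 2) = alt_sum (4 * k + 1) - rudin_shapiro k"
      "alt_sum (4 * k + 3) = alt_sum (4 * k + 2) + (-1) ^ k * rudin_shapiro k"
      "alt_sum (4 * k + 4) = alt_sum (4 * k + 3) + (-1) ^ k * rudin_shapiro k"
      using alt_sum_Suc[of "4 * k"] alt_sum_Suc[of "4 * k + 1", folded e]
        alt_sum_Suc[of "4 * k + 2", folded e] alt_sum_Suc[of "4 * k + 3", folded e]
      unfolding sgn rudin_shapiro_mod4 by simp_all
    show "alt_sum (4 * k + 1) = alt_sum (4 * k) + rudin_shapiro k"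
      "alt_sum (4 * k + 2) = alt_sum (4 * k)"
      "alt_sum (4 * k + 3) = alt_sum (4 * k) + (-1) ^ k * rudin_shapiro k"
      "alt_sum (4 * k + 4) = alt_sum (4 * k) + 2 * ((-1) ^ k * rudin_shapiro k)"
      using s by linarith+
  qed
  show *: "alt_sum (4 * n) = 2 * alt_sum n"
  proof (induction n)
    case (Suc n)
    then show ?case
      using step(4)[of n] alt_sum_Suc[of n] by (simp add: add.commute)
  qed simp
  show "alt_sum (4 * n + 1) = 2 * alt_sum n + rudin_shapiro n"
    "alt_sum (4 * n + 2) = 2 * alt_sum n"
    "alt_sum (4 * n + 3) = alt_sum n + alt_sum (Suc n)"
    using step[of n] * alt_sum_Suc[of n] by simp_all
qed

lemma alt_sum_pair:
  obtains x y where "x = 1 \<or> x = -1" "y = 1 \<or> y = -1"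
    "alt_sum (2 * p + 1) = alt_sum (2 * p) + x"
    "alt_sum (2 * p + 2) = alt_sum (2 * p) + x - y"
    "rudin_shapiro (2 * p) = x" "rudin_shapiro (2 * p + 1) = y"
proof
  show "rudin_shapiro (2 * p) = 1 \<or> rudin_shapiro (2 * p) = -1"
    "rudin_shapiro (2 * p + 1) = 1 \<or> rudin_shapiro (2 * p + 1) = -1"
    by (rule rudin_shapiro_cases)+
qed (use alt_sum_Suc[of "2 * p"] alt_sum_Suc[of "2 * p + 1"] in simp_all)

lemma even_alt_sum: "even (alt_sum (2 * p))"
proof (induction p)
  case (Suc p)
  obtain x y where "x = 1 \<or> x = -1" "y = 1 \<or> y = -1"
    "alt_sum (2 * p + 2) = alt_sum (2 * p) + x - y"
    using alt_sum_pair[of p] by metis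
  with Suc show ?case by auto
qed simp

section \<open>Visit and crossing counts under refinement\<close>

definition visits :: "nat \<Rightarrow> int \<Rightarrow> int" where
  "visits n k = int (card {i. i < n \<and> rs_alt_sum i = k})"

text \<open>The second argument \<open>c\<close> stands for the edge between \<open>c\<close> and \<open>c + 1\<close>; only the steps of
  the walk that start at an even time are counted.\<close>

definition crossings :: "nat \<Rightarrow> int \<Rightarrow> int" where
  "crossings h c = int (card {p. p < h \<and> alt_sum (2 * p) + alt_sum (2 * p + 1) = 2 * c + 1})"

lemma card_less_Suc:
  "int (card {i. i < Suc n \<and> P i}) = int (card {i. i < n \<and> P i}) + of_bool (P n)"
proof (cases "P n")
  case True
  then have "{i. i < Suc n \<and> P i} = insert n {i. i < n \<and> P i}"
    by (auto simp: less_Suc_eq)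
  with True show ?thesis by simp
next
  case False
  then have "{i. i < Suc n \<and> P i} = {i. i < n \<and> P i}"
    by (auto simp: less_Suc_eq)
  with False show ?thesis by simp
qed

lemma card_visits:
  assumes "visits n k = int c"
  shows "card {i. i < n \<and> rs_alt_sum i = k} = c"
  using assms by (simp only: visits_def of_nat_eq_iff)

lemma visits_0 [simp]: "visits 0 k = 0"
  by (simp add: visits_def)

lemma visits_Suc: "visits (Suc n) k = visits n k + of_bool (alt_sum (Suc n) = k)"
  unfolding visits_def by (subst card_less_Suc) (simp add: rs_alt_sum_eq)

lemma visits_double_Suc:
  "visits (2 * Suc h) k =
     visits (2 * h) k + of_bool (alt_sum (2 * h + 1) = k) + of_bool (alt_sum (2 * h + 2) = k)"
  by (simp add: visits_Suc)

lemma visits_quadruple_Suc: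
  "visits (4 * Suc n) k =
     visits (4 * n) k + of_bool (alt_sum (4 * n + 1) = k) + of_bool (alt_sum (4 * n + 2) = k) +
     of_bool (alt_sum (4 * n + 3) = k) + of_bool (alt_sum (4 * Suc n) = k)"
proof -
  have "4 * Suc n = Suc (Suc (Suc (Suc (4 * n))))" by simp
  then show ?thesis by (simp only: visits_Suc) (simp add: eval_nat_numeral)
qed

lemma crossings_0 [simp]: "crossings 0 c = 0"
  by (simp add: crossings_def)

lemma crossings_Suc:
  "crossings (Suc h) c =
     crossings h c + of_bool (alt_sum (2 * h) + alt_sum (2 * h + 1) = 2 * c + 1)"
  unfolding crossings_def by (subst card_less_Suc) simp

text \<open>Even values occur only at times \<open>4 * i\<close> and \<open>4 * i + 2\<close>, where
  the position is \<open>2 * alt_sum i\<close>. In the first case \<open>i\<close> runs from 1 to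
  \<open>n\<close>, as in \<open>visits n\<close>, in the second from 0 to \<open>n - 1\<close>;
  this shift causes the correction terms.\<close>

lemma visits_quadruple_even:
  "visits (4 * n) (2 * j) = 2 * visits n j + of_bool (j = 0) - of_bool (alt_sum n = j)"
proof (induction n)
  case (Suc n)
  have "odd (alt_sum (4 * n + 1))" "odd (alt_sum (4 * n + 3))"
    using rudin_shapiro_cases[of n] alt_sum_mod4[of n] alt_sum_Suc[of n]
    by (cases "even n"; auto)+
  then have "alt_sum (4 * n + 1) \<noteq> 2 * j" "alt_sum (4 * n + 3) \<noteq> 2 * j"
    by (metis dvd_triv_left)+
  then show ?case
    unfolding visits_quadruple_Suc visits_Suc alt_sum_mod4(1) alt_sum_mod4(3)
    using Suc.IH by simp
qed auto

lemma of_bool_disjoint: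
  assumes "P \<or> Q \<longleftrightarrow> R" "\<not> (P \<and> Q)"
  shows "of_bool P + of_bool Q = (of_bool R :: int)"
  using assms by (cases P; cases Q; cases R) auto

text \<open>Bookkeeping for two steps, from \<open>2 * b\<close> to \<open>2 * b + x\<close> to
  \<open>2 * b + x - y\<close>. The excursion of the second one goes against it, so both odd
  neighbours of \<open>2 * (2 * b + x)\<close> are met; as \<open>2 * b + x\<close> is odd,
  \<open>2 * c + 1\<close> is among them exactly if \<open>2 * b + x = j\<close>.\<close>

lemma of_bool_refined_odd:
  fixes b c j x y :: int
  assumes "odd j" "j = c \<or> j = c + 1" "x = 1 \<or> x = -1" "y = 1 \<or> y = -1"
  shows "2 * of_bool (4 * b + x = 2 * c + 1) +
      of_bool (4 * b + 2 * x + y = 2 * c + 1) + of_bool (4 * b + 2 * x - y = 2 * c + 1) =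
      (2 * of_bool (4 * b + x = 2 * c + 1) + of_bool (2 * b + x = j) +
       of_bool (2 * b + x - y = j) :: int)"
proof -
  obtain d where d: "j = 2 * d + 1" using assms(1) by (auto elim: oddE)
  have "2 * b + x - y \<noteq> j" using assms by presburger
  then have "of_bool (2 * b + x - y = j) = (0 :: int)" by simp
  moreover have "4 * b + 2 * x + y = 2 * c + 1 \<or> 4 * b + 2 * x - y = 2 * c + 1 \<longleftrightarrow> 2 * b + x = j"
    using assms d by presburger
  moreover have "\<not> (4 * b + 2 * x + y = 2 * c + 1 \<and> 4 * b + 2 * x - y = 2 * c + 1)"
    using assms by presburger
  ultimately show ?thesis
    using of_bool_disjoint[of "4 * b + 2 * x + y = 2 * c + 1" "4 * b + 2 * x - y = 2 * c + 1"]
    by (simp only: add.assoc[of "2 * _"] add_0_right) simp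
qed

text \<open>At even times the excursion runs along the step itself, so the midpoint of the crossed
  edge is met twice. At odd times it runs the opposite way, giving one hit on each side of the
  current, odd position.\<close>

lemma visits_quadruple_odd:
  assumes "odd j" "j = c \<or> j = c + 1"
  shows "visits (4 * (2 * h)) (2 * c + 1) = 2 * crossings h c + visits (2 * h) j"
proof (induction h)
  case (Suc h)
  obtain x y where xy: "x = 1 \<or> x = -1" "y = 1 \<or> y = -1"
    "alt_sum (2 * h + 1) = alt_sum (2 * h) + x"
    "alt_sum (2 * h + 2) = alt_sum (2 * h) + x - y"
    "rudin_shapiro (2 * h) = x" "rudin_shapiro (2 * h + 1) = y"
    by (rule alt_sum_pair)
  obtain b where b: "alt_sum (2 * h) = 2 * b"
    using even_alt_sum[of h] by (auto elim: evenE)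
  have e: "2 * Suc h = Suc (2 * h + 1)" by simp
  have ev: "visits (4 * (2 * Suc h)) (2 * c + 1) = visits (4 * (2 * h)) (2 * c + 1) +
      2 * of_bool (4 * b + x = 2 * c + 1) +
      of_bool (4 * b + 2 * x + y = 2 * c + 1) + of_bool (4 * b + 2 * x - y = 2 * c + 1)"
  proof -
    have v: "alt_sum (4 * (2 * h) + 1) = 4 * b + x" "alt_sum (4 * (2 * h) + 2) = 4 * b"
      "alt_sum (4 * (2 * h) + 3) = 4 * b + x" "alt_sum (4 * (2 * h + 1)) = 4 * b + 2 * x"
      "alt_sum (4 * (2 * h + 1) + 1) = 4 * b + 2 * x + y"
      "alt_sum (4 * (2 * h + 1) + 2) = 4 * b + 2 * x"
      "alt_sum (4 * (2 * h + 1) + 3) = 4 * b + 2 * x - y"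
      "alt_sum (4 * Suc (2 * h + 1)) = 4 * b + 2 * x - 2 * y"
      unfolding alt_sum_mod4 using xy b by simp_all
    have ne: "4 * b \<noteq> 2 * c + 1" "4 * b + 2 * x \<noteq> 2 * c + 1"
      "4 * b + 2 * x - 2 * y \<noteq> 2 * c + 1"
      by presburger+
    show ?thesis
      unfolding e visits_quadruple_Suc[of "2 * h + 1"]
      unfolding visits_quadruple_Suc[of "2 * h", unfolded Suc_eq_plus1]
      unfolding v using ne by simp
  qed
  note k = of_bool_refined_odd[OF assms xy(1,2), of b]
  have v: "alt_sum (2 * h) + alt_sum (2 * h + 1) = 4 * b + x"
    and w: "alt_sum (2 * h + 1) = 2 * b + x" "alt_sum (2 * h + 2) = 2 * b + x - y"
    using xy(3,4) b by simp_all
  show ?case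
    unfolding ev visits_double_Suc crossings_Suc v unfolding w Suc.IH distrib_left using k by linarith
qed simp

text \<open>Even-timed steps lead from even to odd positions. An odd \<open>j\<close> is thus the
  end of such a step; an even \<open>j\<close> is its start, at times from 0 to
  \<open>2 * h - 2\<close>, whereas \<open>visits\<close> counts the even times from 2 to
  \<open>2 * h\<close>.\<close>

lemma crossings_adjacent:
  "crossings h j + crossings h (j - 1) =
     visits (2 * h) j + (if even j then of_bool (j = 0) - of_bool (alt_sum (2 * h) = j) else 0)"
proof (induction h)
  case (Suc h)
  obtain x y where xy: "x = 1 \<or> x = -1" "y = 1 \<or> y = -1"
    "alt_sum (2 * h + 1) = alt_sum (2 * h) + x"
    "alt_sum (2 * h + 2) = alt_sum (2 * h) + x - y"
    by (rule alt_sum_pair)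
  obtain b where b: "alt_sum (2 * h) = 2 * b"
    using even_alt_sum[of h] by (auto elim: evenE)
  have k: "of_bool (4 * b + x = 2 * j + 1) + of_bool (4 * b + x = 2 * j - 1) =
      (of_bool (2 * b = j) + of_bool (2 * b + x = j) :: int)"
    (is "of_bool ?P + of_bool ?Q = of_bool ?R + of_bool ?S")
  proof (rule trans[OF of_bool_disjoint of_bool_disjoint[symmetric]])
    show "?P \<or> ?Q \<longleftrightarrow> ?R \<or> ?S" using xy(1) by presburger
    show "?R \<or> ?S \<longleftrightarrow> ?R \<or> ?S" ..
    show "\<not> (?P \<and> ?Q)" by presburger
    show "\<not> (?R \<and> ?S)" using xy(1) by presburger
  qed
  have v: "alt_sum (2 * h) + alt_sum (2 * h + 1) = 4 * b + x"
    and w: "alt_sum (2 * h + 1) = 2 * b + x" "alt_sum (2 * Suc h) = 2 * b + x - y"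
      "alt_sum (2 * h + 2) = 2 * b + x - y"
    using xy(3,4) b by simp_all
  have d: "2 * (j - 1) + 1 = 2 * j - 1" by simp
  have p: "even j \<Longrightarrow> 2 * b + x \<noteq> j" "odd j \<Longrightarrow> 2 * b \<noteq> j" "odd j \<Longrightarrow> 2 * b + x - y \<noteq> j"
    using xy(1,2) by auto
  note IH = Suc.IH[unfolded b]
  show ?case
    unfolding visits_double_Suc crossings_Suc v d unfolding w
    using IH k p by (cases "even j") simp_all
qed auto

text \<open>The correction terms in the second and fourth condition depend on whether the walk of length
  \<open>2 * h\<close> ends at \<open>0\<close> (half range) or at \<open>w\<close> (full range), so that both parts of the theorem share
  one invariant.\<close>

definition tent :: "int \<Rightarrow> int \<Rightarrow> nat \<Rightarrow> bool" where
  "tent s w h \<longleftrightarrow>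
     (\<forall>k<0. visits (2 * h) k = 0) \<and>
     2 * (visits (2 * h) 0 + 1 - of_bool (alt_sum (2 * h) = 0)) = s * w \<and>
     (\<forall>k. 1 \<le> k \<and> k < w \<longrightarrow> visits (2 * h) k = s * (w - k)) \<and>
     visits (2 * h) w = of_bool (alt_sum (2 * h) = w) \<and>
     even w \<and> w > 0 \<and> (alt_sum (2 * h) = 0 \<or> alt_sum (2 * h) = w)"

lemma tent_visits:
  assumes "tent s w h"
  shows "2 * (visits (2 * h) 0 + 1 - of_bool (alt_sum (2 * h) = 0)) = s * w"
    "visits (2 * h) w = of_bool (alt_sum (2 * h) = w)"
    "\<forall>k. 1 \<le> k \<and> k < w \<longrightarrow> visits (2 * h) k = s * (w - k)"
  using assms unfolding tent_def by blast+

section \<open>Propagation of the linear profile\<close>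

lemma crossings_nonneg: "crossings h c \<ge> 0"
  by (simp add: crossings_def)

lemma tent_crossings_neg:
  assumes "tent s w h" "c < 0"
  shows "crossings h c = 0"
proof -
  have "crossings h c + crossings h (c - 1) \<le> 0"
    using crossings_adjacent[of h c] assms by (auto simp: tent_def)
  then show ?thesis using crossings_nonneg[of h c] crossings_nonneg[of h "c - 1"] by linarith
qed

text \<open>Going up edge by edge, the linear visit numbers leave a staircase that falls by
  \<open>s\<close> on reaching each odd edge.\<close>

lemma tent_crossings:
  assumes "tent s w h" "int c < w"
  shows "2 * crossings h (int c) = s * (w - 2 * ((int c + 1) div 2))"
  using assms(2)
proof (induction c)
  case 0
  \<comment> \<open>The edge below 0 is never crossed, so the second condition of
    \<open>tent\<close> gives the starting value.\<close>
  then show ?case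
    using crossings_adjacent[of h 0] tent_crossings_neg[OF assms(1), of "-1"] assms(1)
    by (simp add: tent_def)
next
  case (Suc c)
  let ?j = "int (Suc c)"
  \<comment> \<open>The correction vanishes: the walk ends at 0 or \<open>w\<close>, and
    \<open>?j\<close> lies strictly between.\<close>
  have adj: "crossings h ?j + crossings h (int c) = visits (2 * h) ?j"
    using crossings_adjacent[of h ?j] assms(1) Suc.prems by (auto simp: tent_def)
  have v: "visits (2 * h) ?j = s * (w - ?j)"
    using assms(1) Suc.prems by (simp add: tent_def)
  have IH: "2 * crossings h (int c) = s * (w - 2 * (?j div 2))"
    using Suc by (simp add: add.commute)
  have d: "2 * ((?j + 1) div 2) = 2 * ?j - 2 * (?j div 2)" by presburger
  have "2 * crossings h ?j = 2 * (s * (w - ?j)) - s * (w - 2 * (?j div 2))"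
    using adj v IH by linarith
  also have "\<dots> = s * (w - (2 * ?j - 2 * (?j div 2)))" by (simp add: algebra_simps)
  finally show ?case unfolding d .
qed

lemma tent_quadruple:
  assumes "tent s w h"
  shows "tent s (2 * w) (4 * h)"
proof -
  have e: "2 * (4 * h) = 4 * (2 * h)" by simp
  note t = assms[unfolded tent_def]
  then have "even w" by blast
  have neg: "visits (4 * (2 * h)) k = 0" if "k < 0" for k
  proof (cases "even k")
    case True
    then obtain j where "k = 2 * j" by (auto elim: evenE)
    then show ?thesis using visits_quadruple_even[of "2 * h" j] t that by auto
  next
    case False
    then obtain c where c: "k = 2 * c + 1" by (auto elim: oddE)
    with that have "c < 0" by simp
    define j where "j = (if odd c then c else c + 1)"
    have j: "odd j" "j = c \<or> j = c + 1" "j < 0"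
      using \<open>c < 0\<close> by (auto simp: j_def)
    show ?thesis
      using visits_quadruple_odd[OF j(1,2), of h] tent_crossings_neg[OF assms \<open>c < 0\<close>] t j(3)
      by (simp add: c)
  qed
  have mid: "visits (4 * (2 * h)) k = s * (2 * w - k)" if "1 \<le> k" "k < 2 * w" for k
  proof (cases "even k")
    case True
    then obtain j where k: "k = 2 * j" by (auto elim: evenE)
    with that have j: "1 \<le> j" "j < w" by auto
    then have "visits (4 * (2 * h)) k = 2 * visits (2 * h) j"
      using visits_quadruple_even[of "2 * h" j] t by (auto simp: k)
    moreover have "visits (2 * h) j = s * (w - j)" using t j by simp
    ultimately show ?thesis by (simp add: k algebra_simps)
  next
    case False
    then obtain c where c: "k = 2 * c + 1" by (auto elim: oddE)
    with that have "0 \<le> c" "c < w" by simp_all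
    define j where "j = (if odd c then c else c + 1)"
    have j: "odd j" "j = c \<or> j = c + 1" by (auto simp: j_def)
    \<comment> \<open>Since \<open>c < w\<close>, only \<open>j = w\<close> must be excluded; there
      the parities differ.\<close>
    have jw: "1 \<le> j" "j < w"
      using j \<open>0 \<le> c\<close> \<open>c < w\<close> \<open>even w\<close> by presburger+
    \<comment> \<open>The staircase of the crossings and the parity jumps of \<open>j\<close>
      compensate, which restores linearity in \<open>k\<close>.\<close>
    have cd: "2 * ((c + 1) div 2) + j = 2 * c + 1"
      unfolding j_def by presburger
    have "2 * crossings h c = s * (w - 2 * ((c + 1) div 2))"
      using tent_crossings[OF assms, of "nat c"] \<open>0 \<le> c\<close> \<open>c < w\<close> by simp
    then have "visits (4 * (2 * h)) k = s * (w - 2 * ((c + 1) div 2)) + s * (w - j)"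
      using visits_quadruple_odd[OF j, of h] t jw by (simp add: c)
    also have "\<dots> = s * (2 * w - (2 * ((c + 1) div 2) + j))" by (simp add: algebra_simps)
    finally show ?thesis unfolding cd c .
  qed
  show ?thesis
    unfolding tent_def e
    using neg mid visits_quadruple_even[of "2 * h" 0] visits_quadruple_even[of "2 * h" w]
      t alt_sum_mod4(1)[of "2 * h"]
    by auto
qed

section \<open>The two base walks and the final counts\<close>

lemma alt_sum_small:
  "alt_sum 1 = 1" "alt_sum 2 = 0" "alt_sum 3 = 1" "alt_sum 4 = 2"
  using alt_sum_mod4[of 0] alt_sum_mod4(1)[of 1] alt_sum_Suc[of 0]
  by (simp_all add: rudin_shapiro_0 numeral_2_eq_2)

lemma visits_small:
  "visits 1 k = of_bool (k = 1)"
  "visits 2 k = of_bool (k = 1) + of_bool (k = 0)"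
  "visits 4 k = 2 * of_bool (k = 1) + of_bool (k = 0) + of_bool (k = 2)"
  using alt_sum_small by (simp_all add: visits_Suc eval_nat_numeral)

text \<open>The base walk is 0, 1, 0; doubling keeps its end at 0.\<close>

lemma tent_half: "tent 1 (2 ^ Suc m) (4 ^ m) \<and> alt_sum (2 * 4 ^ m) = 0"
proof (induction m)
  case 0
  show ?case by (auto simp: tent_def visits_small alt_sum_small)
next
  case (Suc m)
  then show ?case
    using tent_quadruple alt_sum_mod4(1)[of "2 * 4 ^ m"] by fastforce
qed

text \<open>The base walk is 0, 1, 0, 1, 2; its end point doubles together with the width.\<close>

lemma tent_full: "tent 2 (2 ^ Suc m) (2 * 4 ^ m) \<and> alt_sum (4 ^ Suc m) = 2 ^ Suc m"
proof (induction m)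
  case 0
  show ?case by (auto simp: tent_def visits_small alt_sum_small)
next
  case (Suc m)
  then show ?case
    using tent_quadruple[of 2 "2 ^ Suc m" "2 * 4 ^ m"] alt_sum_mod4(1)[of "4 ^ Suc m"]
    by (simp add: mult.left_commute)
qed

theorem theorem28:
  shows "(\<forall>m::nat. m \<ge> 1 \<longrightarrow>
            card {n. n < 4 ^ m div 2 \<and> rs_alt_sum n = 0} = 2 ^ (m - 1) \<and>
            (\<forall>k::int. 1 \<le> k \<and> k < 2 ^ m \<longrightarrow>
               int (card {n. n < 4 ^ m div 2 \<and> rs_alt_sum n = k}) = 2 ^ m - k)) \<and>
         (\<forall>m::nat.
            card {n. n < 4 ^ m \<and> rs_alt_sum n = 0} = 2 ^ m - 1 \<and>
            card {n. n < 4 ^ m \<and> rs_alt_sum n = 2 ^ m} = 1 \<and>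
            (\<forall>k::int. 1 \<le> k \<and> k < 2 ^ m \<longrightarrow>
               int (card {n. n < 4 ^ m \<and> rs_alt_sum n = k}) = 2 * (2 ^ m - k)))"
proof (rule conjI; intro allI impI)
  fix m :: nat
  assume "m \<ge> 1"
  then obtain r where m: "m = Suc r" by (cases m) auto
  have L: "4 ^ m div 2 = 2 * (4 ^ r :: nat)" by (simp add: m)
  note t = tent_visits[OF conjunct1[OF tent_half[of r]], folded L m]
  have "alt_sum (4 ^ m div 2) = 0" using tent_half[of r] by (simp only: L)
  then have "visits (4 ^ m div 2) 0 = 2 ^ r" using t(1) by (simp add: m)
  moreover have "\<forall>k. 1 \<le> k \<and> k < 2 ^ m \<longrightarrow> visits (4 ^ m div 2) k = 2 ^ m - k"
    using t(3) unfolding mult_1 .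
  ultimately show "card {n. n < 4 ^ m div 2 \<and> rs_alt_sum n = 0} = 2 ^ (m - 1) \<and>
            (\<forall>k::int. 1 \<le> k \<and> k < 2 ^ m \<longrightarrow>
               int (card {n. n < 4 ^ m div 2 \<and> rs_alt_sum n = k}) = 2 ^ m - k)"
    using card_visits[of "4 ^ m div 2" 0 "2 ^ r"] unfolding visits_def[symmetric] by (simp add: m)
next
  fix m :: nat
  have "visits (4 ^ m) 0 = 2 ^ m - 1 \<and> visits (4 ^ m) (2 ^ m) = 1 \<and>
    (\<forall>k. 1 \<le> k \<and> k < 2 ^ m \<longrightarrow> visits (4 ^ m) k = 2 * (2 ^ m - k))"
  proof (cases m)
    \<comment> \<open>Here the width is 1, but \<open>tent\<close> requires an even one, so the
      single time is checked directly.\<close>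
    case 0
    then show ?thesis using visits_small(1) by simp
  next
    case (Suc r)
    have L: "2 * (2 * 4 ^ r) = (4 ^ m :: nat)" by (simp add: Suc)
    note t = tent_visits[OF conjunct1[OF tent_full[of r]], unfolded L, folded Suc]
    have z: "alt_sum (4 ^ m) = 2 ^ m" using tent_full[of r] by (simp only: Suc)
    have "visits (4 ^ m) 0 = 2 ^ m - 1" using t(1) unfolding z by simp
    moreover have "visits (4 ^ m) (2 ^ m) = 1" using t(2) unfolding z by simp
    ultimately show ?thesis using t(3) by blast
  qed
  then show "card {n. n < 4 ^ m \<and> rs_alt_sum n = 0} = 2 ^ m - 1 \<and>
            card {n. n < 4 ^ m \<and> rs_alt_sum n = 2 ^ m} = 1 \<and>
            (\<forall>k::int. 1 \<le> k \<and> k < 2 ^ m \<longrightarrow>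
               int (card {n. n < 4 ^ m \<and> rs_alt_sum n = k}) = 2 * (2 ^ m - k))"
    using card_visits[of "4 ^ m" 0 "2 ^ m - 1"] card_visits[of "4 ^ m" "2 ^ m" 1]
    unfolding visits_def[symmetric] by (simp add: of_nat_diff)
qed

end
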